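(* Let $G$ be a finite graph with at least two vertices and let $u \in (0,\tfrac12]$. Let $B_u(G)$ be the smallest degree of an effective divisor $D$ on $G$ such that every connected component of $V(G)\smallsetminus \operatorname{supp}(D)$ has size (number of vertices) at most $u|V(G)|$. Then \[ \operatorname{gon}(G) \geq \min\left\{ B_u(G),\; h(G)\,u\,|V(G)| \right\}. \]
   Context: Graphs are finite and may have multiple edges; $\varepsilon(v,w)$ is the number of edges between distinct vertices $v,w$. Loops, if present, play no role in chip-firing. A divisor on $G$ is a formal $\mathbb{Z}$-linear combination $D=\sum_v D(v)\,v$ of vertices; its degree is $\sum_v D(v)$. It is effective if $D(v)\ge 0$ for all $v$, and then its support is $\operatorname{supp}(D)=\{v : D(v)>0\}$. Firing a vertex $v$ replaces $D$ by $D'$ with $D'(v)=D(v)-\sum_{w\ne v}\varepsilon(v,w)$ and $D'(w)=D(w)+\varepsilon(w,v)$ for $w\neq v$. Two divisors are equivalent if they differ by an integer combination of firing moves, i.e. their difference lies in the image of $\mathbb{Z}^{V(G)}$ under the graph Laplacian. A divisor $D$ has positive rank if for every vertex $v$ the divisor $D-v$ is equivalent to an effective divisor. The gonality $\operatorname{gon}(G)$ is the smallest degree of a divisor on $G$ of positive rank. Connected components of a vertex set are those of the subgraph it induces. For $U\subseteq V(G)$, $\partial U$ is the set of edges with exactly one endpoint in $U$. The Cheeger constant is \[ h(G)=\min_{0<|U|\le \frac12|V(G)|}\frac{|\partial U|}{|U|}. \] *)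

theory Defs imports Complex_Main begin

text \<open>Multigraphs with named edges. The set \<open>ends G e\<close> has two elements for an ordinary edge
  and one element for a loop.\<close>

record ('v, 'e) multigraph =
  verts :: "'v set"
  edges :: "'e set"
  ends :: "'e \<Rightarrow> 'v set"

definition finite_multigraph :: "('v, 'e) multigraph \<Rightarrow> bool" where
  "finite_multigraph G \<longleftrightarrow> finite (verts G) \<and> finite (edges G) \<and>
     (\<forall>e\<in>edges G. ends G e \<subseteq> verts G \<and> card (ends G e) \<in> {1, 2})"

text \<open>Number of edges between \<open>v\<close> and \<open>w\<close>; only used for \<open>v \<noteq> w\<close>.\<close>

definition mult :: "('v, 'e) multigraph \<Rightarrow> 'v \<Rightarrow> 'v \<Rightarrow> nat" where
  "mult G v w = card {e \<in> edges G. ends G e = {v, w}}"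

definition adjacent :: "('v, 'e) multigraph \<Rightarrow> ('v \<times> 'v) set" where
  "adjacent G = {(v, w). v \<in> verts G \<and> w \<in> verts G \<and> v \<noteq> w \<and> mult G v w > 0}"

definition induced :: "('v, 'e) multigraph \<Rightarrow> 'v set \<Rightarrow> ('v, 'e) multigraph" where
  "induced G U = \<lparr>verts = U, edges = {e \<in> edges G. ends G e \<subseteq> U}, ends = ends G\<rparr>"

definition components :: "('v, 'e) multigraph \<Rightarrow> 'v set set" where
  "components G = (\<lambda>v. {w. (v, w) \<in> (adjacent G)\<^sup>*}) ` verts G"

text \<open>A loop at a vertex of \<open>U\<close> does not belong to the boundary, since both its endpoints lie
  in \<open>U\<close>.\<close>

definition edge_boundary :: "('v, 'e) multigraph \<Rightarrow> 'v set \<Rightarrow> 'e set" where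
  "edge_boundary G U = {e \<in> edges G. \<exists>v\<in>ends G e. \<exists>w\<in>ends G e. v \<in> U \<and> w \<notin> U}"

definition cheeger :: "('v, 'e) multigraph \<Rightarrow> real" where
  "cheeger G = Min ((\<lambda>U. real (card (edge_boundary G U)) / real (card U)) `
     {U. U \<subseteq> verts G \<and> 0 < card U \<and> real (card U) \<le> 1/2 * real (card (verts G))})"

text \<open>Divisors are integer functions on all of \<open>'v\<close> that vanish off the vertex set.\<close>

definition divisors :: "('v, 'e) multigraph \<Rightarrow> ('v \<Rightarrow> int) set" where
  "divisors G = {D. \<forall>v. v \<notin> verts G \<longrightarrow> D v = 0}"

definition deg :: "('v, 'e) multigraph \<Rightarrow> ('v \<Rightarrow> int) \<Rightarrow> int" where
  "deg G D = (\<Sum>v\<in>verts G. D v)"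

definition effective :: "('v, 'e) multigraph \<Rightarrow> ('v \<Rightarrow> int) \<Rightarrow> bool" where
  "effective G D \<longleftrightarrow> D \<in> divisors G \<and> (\<forall>v\<in>verts G. D v \<ge> 0)"

definition supp :: "('v, 'e) multigraph \<Rightarrow> ('v \<Rightarrow> int) \<Rightarrow> 'v set" where
  "supp G D = {v \<in> verts G. D v > 0}"

text \<open>\<open>firing G v\<close> is the change \<open>D' - D\<close> caused by firing \<open>v\<close>.\<close>

definition firing :: "('v, 'e) multigraph \<Rightarrow> 'v \<Rightarrow> 'v \<Rightarrow> int" where
  "firing G v w = (if w = v then - (\<Sum>x\<in>verts G - {v}. int (mult G v x)) else int (mult G v w))"

definition equivalent :: "('v, 'e) multigraph \<Rightarrow> ('v \<Rightarrow> int) \<Rightarrow> ('v \<Rightarrow> int) \<Rightarrow> bool" where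
  "equivalent G D D' \<longleftrightarrow>
     (\<exists>c :: 'v \<Rightarrow> int. \<forall>w\<in>verts G. D' w - D w = (\<Sum>v\<in>verts G. c v * firing G v w))"

definition positive_rank :: "('v, 'e) multigraph \<Rightarrow> ('v \<Rightarrow> int) \<Rightarrow> bool" where
  "positive_rank G D \<longleftrightarrow> D \<in> divisors G \<and>
     (\<forall>v\<in>verts G. \<exists>E. effective G E \<and> equivalent G (\<lambda>w. D w - (if w = v then 1 else 0)) E)"

text \<open>Both minima below are taken over sets of integers; that they are attained is
  shown at the end of this theory.\<close>

definition gonality :: "('v, 'e) multigraph \<Rightarrow> int" where
  "gonality G = (LEAST d. \<exists>D. positive_rank G D \<and> deg G D = d)"

definition separating_degree :: "('v, 'e) multigraph \<Rightarrow> real \<Rightarrow> int" where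
  "separating_degree G u = (LEAST d. \<exists>D. effective G D \<and>
     (\<forall>C\<in>components (induced G (verts G - supp G D)).
        real (card C) \<le> u * real (card (verts G))) \<and> deg G D = d)"

lemma ex_least_int:
  fixes P :: "int \<Rightarrow> bool"
  assumes "P a" and lb: "\<And>d. P d \<Longrightarrow> 0 \<le> d"
  shows "P (LEAST d. P d) \<and> (\<forall>d. P d \<longrightarrow> (LEAST d. P d) \<le> d)"
proof -
  define m where "m = int (LEAST n. P (int n))"
  have "P (int (nat a))" using assms by simp
  then have Pm: "P m" unfolding m_def by (rule LeastI)
  have le: "m \<le> d" if "P d" for d
    using Least_le[of "\<lambda>n. P (int n)" "nat d"] that lb[OF that] by (simp add: m_def)
  have "(LEAST d. P d) = m" by (rule Least_equality) (use Pm le in auto)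
  then show ?thesis using Pm le by auto
qed

lemma deg_equivalent:
  assumes "finite_multigraph G" and "equivalent G D D'"
  shows "deg G D' = deg G D"
proof -
  have fin: "finite (verts G)" using assms(1) by (simp add: finite_multigraph_def)
  obtain c where c: "\<And>w. w \<in> verts G \<Longrightarrow> D' w - D w = (\<Sum>v\<in>verts G. c v * firing G v w)"
    using assms(2) unfolding equivalent_def by blast
  have z: "(\<Sum>w\<in>verts G. firing G v w) = 0" if "v \<in> verts G" for v
    by (subst sum.remove[OF fin that]) (simp add: firing_def)
  have "deg G D' - deg G D = (\<Sum>w\<in>verts G. \<Sum>v\<in>verts G. c v * firing G v w)"
    unfolding deg_def by (simp add: sum_subtractf[symmetric] c)
  also have "\<dots> = (\<Sum>v\<in>verts G. c v * (\<Sum>w\<in>verts G. firing G v w))"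
    by (subst sum.swap) (simp add: sum_distrib_left)
  finally show ?thesis by (simp add: z)
qed

lemma deg_effective_nonneg: "effective G D \<Longrightarrow> 0 \<le> deg G D"
  by (simp add: effective_def deg_def sum_nonneg)

lemma deg_positive_rank:
  assumes "finite_multigraph G" "verts G \<noteq> {}" "positive_rank G D"
  shows "1 \<le> deg G D"
proof -
  have fin: "finite (verts G)" using assms(1) by (simp add: finite_multigraph_def)
  obtain v where v: "v \<in> verts G" using assms(2) by blast
  obtain E where E: "effective G E" "equivalent G (\<lambda>w. D w - (if w = v then 1 else 0)) E"
    using assms(3) v unfolding positive_rank_def by blast
  have "deg G E = deg G D - 1"
    using deg_equivalent[OF assms(1) E(2)] v fin by (simp add: deg_def sum_subtractf)
  then show ?thesis using deg_effective_nonneg[OF E(1)] by simp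
qed

lemma gonality_attained:
  assumes "finite_multigraph G" "verts G \<noteq> {}"
  shows "(\<exists>D. positive_rank G D \<and> deg G D = gonality G) \<and>
    (\<forall>D. positive_rank G D \<longrightarrow> gonality G \<le> deg G D)"
proof -
  let ?D = "\<lambda>v. if v \<in> verts G then 1 else 0 :: int"
  have "\<exists>E. effective G E \<and> equivalent G (\<lambda>w. ?D w - (if w = v then 1 else 0)) E"
    if v: "v \<in> verts G" for v
    by (rule exI[of _ "\<lambda>w. ?D w - (if w = v then 1 else 0)"])
      (use v in \<open>auto simp: effective_def divisors_def equivalent_def intro: exI[of _ "\<lambda>_. 0"]\<close>)
  then have "positive_rank G ?D" by (simp add: positive_rank_def divisors_def)
  then show ?thesis
    using ex_least_int[of "\<lambda>d. \<exists>D. positive_rank G D \<and> deg G D = d" "deg G ?D"]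
      deg_positive_rank[OF assms]
    unfolding gonality_def by fastforce
qed

lemma separating_degree_attained:
  assumes "0 \<le> u"
  shows "(\<exists>D. effective G D \<and>
     (\<forall>C\<in>components (induced G (verts G - supp G D)).
        real (card C) \<le> u * real (card (verts G))) \<and> deg G D = separating_degree G u) \<and>
    (\<forall>D. effective G D \<and> (\<forall>C\<in>components (induced G (verts G - supp G D)).
        real (card C) \<le> u * real (card (verts G))) \<longrightarrow> separating_degree G u \<le> deg G D)"
proof -
  let ?P = "\<lambda>D. effective G D \<and> (\<forall>C\<in>components (induced G (verts G - supp G D)).
        real (card C) \<le> u * real (card (verts G)))"
  let ?D = "\<lambda>v. if v \<in> verts G then 1 else 0 :: int"
  have "supp G ?D = verts G" by (auto simp: supp_def)
  then have "?P ?D"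
    by (simp add: effective_def divisors_def components_def induced_def)
  then show ?thesis
    using ex_least_int[of "\<lambda>d. \<exists>D. effective G D \<and>
     (\<forall>C\<in>components (induced G (verts G - supp G D)).
        real (card C) \<le> u * real (card (verts G))) \<and> deg G D = d" "deg G ?D"]
      deg_effective_nonneg[of G]
    unfolding separating_degree_def by blast
qed

end

theory Submission imports Defs begin

text \<open>
  The proof plays the bramble argument that bounds gonality below by treewidth, with the Cheeger
  constant doing the work of the bramble axiom.

  Suppose a divisor of positive rank has degree less than both bounds, and call a connected vertex
  set with more than \<open>u |V|\<close> vertices large. Among the effective divisors equivalent to it, choose
  \<open>E\<close> such that the family of large sets hit by \<open>supp E\<close> is maximal under inclusion. Since the
  degree is below \<open>B\<^sub>u(G)\<close>, some component \<open>B\<close> of \<open>V - supp E\<close> is large; by positive rank there is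
  an equivalent effective \<open>E'\<close> that hits \<open>B\<close>. If \<open>c\<close> is a firing script from \<open>E\<close> to \<open>E'\<close>, then the
  truncated scripts \<open>max c t\<close> lead from \<open>E\<close> to \<open>E'\<close> through effective divisors as \<open>t\<close> decreases
  (\<open>effective_fire_truncated\<close>), the step from \<open>t\<close> to \<open>t - 1\<close> firing the level set \<open>{c \<ge> t}\<close>
  (\<open>fire_truncated_inside\<close>, \<open>fire_truncated_outside\<close>).

  A connected set that such a step changes from missed to hit lies outside the fired set, and one
  that changes from hit to missed lies inside it. At the step \<open>s\<close> where \<open>B\<close> becomes hit, maximality
  of \<open>E\<close> yields a large set \<open>B'\<close> that was hit at the start and is missed now. It was lost at
  some threshold \<open>t \<ge> s\<close>, so \<open>B'\<close> lies in \<open>{c \<ge> t}\<close>, hence in \<open>U = {c \<ge> s}\<close>, while \<open>B\<close> lies in the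
  complement. Thus \<open>U\<close> and its complement both have more than \<open>u |V|\<close> vertices, and
  \<open>|\<partial>U| > h(G) u |V|\<close>. But firing \<open>U\<close> sends a chip along each edge of \<open>\<partial>U\<close> and leaves an effective
  divisor, so \<open>|\<partial>U|\<close> is at most the degree, a contradiction.
\<close>

section \<open>Firing scripts\<close>

lemma mult_commute: "mult G v w = mult G w v"
  by (simp add: mult_def insert_commute)

text \<open>Written as a sum of flows along edges, the effect of a script depends only on the
  differences of its values, so truncating the script can be followed term by term.\<close>

definition fire :: "('v, 'e) multigraph \<Rightarrow> ('v \<Rightarrow> int) \<Rightarrow> ('v \<Rightarrow> int) \<Rightarrow> 'v \<Rightarrow> int" where
  "fire G D c w =
     (if w \<in> verts G then D w + (\<Sum>v\<in>verts G. int (mult G w v) * (c v - c w)) else 0)"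

lemma sum_firing_eq_flow:
  assumes "finite (verts G)" "w \<in> verts G"
  shows "(\<Sum>v\<in>verts G. c v * firing G v w) = (\<Sum>v\<in>verts G. int (mult G w v) * (c v - c w))"
proof -
  have off: "firing G v w = int (mult G w v)" if "v \<noteq> w" for v
    using that mult_commute[of G v w] by (simp add: firing_def)
  have "(\<Sum>v\<in>verts G. c v * firing G v w) =
      (\<Sum>v\<in>verts G - {w}. c v * int (mult G w v)) - c w * (\<Sum>v\<in>verts G - {w}. int (mult G w v))"
    by (subst sum.remove[OF assms]) (simp add: off, simp add: firing_def)
  also have "\<dots> = (\<Sum>v\<in>verts G - {w}. int (mult G w v) * (c v - c w))"
    by (simp add: sum_distrib_left sum_subtractf[symmetric] algebra_simps)
  also have "\<dots> = (\<Sum>v\<in>verts G. int (mult G w v) * (c v - c w))"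
    by (simp add: sum.remove[OF assms])
  finally show ?thesis .
qed

lemma equivalent_iff_fire:
  assumes "finite (verts G)"
  shows "equivalent G D D' \<longleftrightarrow> (\<exists>c. \<forall>w\<in>verts G. D' w = fire G D c w)"
  unfolding equivalent_def fire_def
  by (simp add: sum_firing_eq_flow[OF assms] diff_eq_eq add.commute cong: ball_cong)

lemma equivalent_sym:
  assumes "equivalent G D D'"
  shows "equivalent G D' D"
proof -
  obtain c where c: "\<forall>w\<in>verts G. D' w - D w = (\<Sum>v\<in>verts G. c v * firing G v w)"
    using assms unfolding equivalent_def by blast
  have "\<forall>w\<in>verts G. D w - D' w = (\<Sum>v\<in>verts G. - c v * firing G v w)"
    using c by (force simp: sum_negf)
  then show ?thesis
    unfolding equivalent_def by (intro exI[of _ "\<lambda>v. - c v"])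
qed

lemma equivalent_trans:
  assumes "equivalent G D D'" "equivalent G D' D''"
  shows "equivalent G D D''"
proof -
  obtain c where c: "\<forall>w\<in>verts G. D' w - D w = (\<Sum>v\<in>verts G. c v * firing G v w)"
    using assms(1) unfolding equivalent_def by blast
  obtain d where d: "\<forall>w\<in>verts G. D'' w - D' w = (\<Sum>v\<in>verts G. d v * firing G v w)"
    using assms(2) unfolding equivalent_def by blast
  have "\<forall>w\<in>verts G. D'' w - D w = (\<Sum>v\<in>verts G. (c v + d v) * firing G v w)"
    using c d by (force simp: distrib_right sum.distrib)
  then show ?thesis
    unfolding equivalent_def by (intro exI[of _ "\<lambda>v. c v + d v"])
qed

lemma positive_rank_chip_at:
  assumes "finite (verts G)" "positive_rank G D" "v \<in> verts G"
  shows "\<exists>E. effective G E \<and> equivalent G D E \<and> v \<in> supp G E"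
proof -
  obtain E where E: "effective G E" "equivalent G (\<lambda>w. D w - (if w = v then 1 else 0)) E"
    using assms(2,3) unfolding positive_rank_def by blast
  let ?E = "\<lambda>w. E w + (if w = v then 1 else 0)"
  have "equivalent G D ?E"
    using E(2) unfolding equivalent_def by (simp add: algebra_simps)
  moreover have "effective G ?E"
    using E(1) assms(3) by (auto simp: effective_def divisors_def)
  moreover have "v \<in> supp G ?E"
    using E(1) assms(3) by (auto simp: supp_def effective_def add_nonneg_pos)
  ultimately show ?thesis by blast
qed

section \<open>Truncated scripts\<close>

text \<open>Where \<open>c \<ge> t\<close>, truncation keeps the value at the vertex and can only raise the others, so
  the vertex has at least the chips that the full script leaves it; where \<open>c < t\<close>, the truncated script takes its least value, so
  the vertex has only gained chips.\<close>

lemma effective_fire_truncated: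
  assumes "effective G D" "effective G (fire G D c)"
  shows "effective G (fire G D (\<lambda>v. max (c v) t))"
  unfolding effective_def
proof (intro conjI ballI)
  show "fire G D (\<lambda>v. max (c v) t) \<in> divisors G"
    by (simp add: divisors_def fire_def)
next
  fix w assume w: "w \<in> verts G"
  show "0 \<le> fire G D (\<lambda>v. max (c v) t) w"
  proof (cases "t \<le> c w")
    case True
    have "fire G D c w \<le> fire G D (\<lambda>v. max (c v) t) w"
      using w True by (auto simp: fire_def intro!: sum_mono mult_left_mono)
    then show ?thesis using assms(2) w by (force simp: effective_def)
  next
    case False
    have "D w \<le> fire G D (\<lambda>v. max (c v) t) w"
      using w False by (auto simp: fire_def intro!: sum_nonneg mult_nonneg_nonneg)
    then show ?thesis using assms(1) w by (force simp: effective_def)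
  qed
qed

lemma fire_truncated_inside:
  assumes fin: "finite (verts G)" and w: "w \<in> verts G" "t \<le> c w"
  shows "fire G D (\<lambda>v. max (c v) t) w =
    fire G D (\<lambda>v. max (c v) (t - 1)) w + (\<Sum>v\<in>{v\<in>verts G. c v < t}. int (mult G w v))"
proof -
  have "(\<Sum>v\<in>verts G. int (mult G w v) * (max (c v) t - max (c w) t)) =
      (\<Sum>v\<in>verts G. int (mult G w v) * (max (c v) (t - 1) - max (c w) (t - 1))
         + (if c v < t then int (mult G w v) else 0))"
    using w by (intro sum.cong) (auto simp: algebra_simps max_def)
  then show ?thesis using fin w by (simp add: fire_def sum.distrib sum.inter_filter)
qed

lemma fire_truncated_outside:
  assumes fin: "finite (verts G)" and w: "w \<in> verts G" "c w < t"
  shows "fire G D (\<lambda>v. max (c v) (t - 1)) w =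
    fire G D (\<lambda>v. max (c v) t) w + (\<Sum>v\<in>{v\<in>verts G. t \<le> c v}. int (mult G w v))"
proof -
  have "(\<Sum>v\<in>verts G. int (mult G w v) * (max (c v) (t - 1) - max (c w) (t - 1))) =
      (\<Sum>v\<in>verts G. int (mult G w v) * (max (c v) t - max (c w) t)
         + (if t \<le> c v then int (mult G w v) else 0))"
    using w by (intro sum.cong) (auto simp: algebra_simps max_def)
  then show ?thesis using fin w by (simp add: fire_def sum.distrib sum.inter_filter)
qed

section \<open>Connected sets and level sets\<close>

text \<open>Connectedness as the absence of a split without crossing edges: this is the form in which it
  meets a level set of the script.\<close>

definition connected_set :: "('v, 'e) multigraph \<Rightarrow> 'v set \<Rightarrow> bool" where
  "connected_set G B \<longleftrightarrow> (\<forall>X. B \<inter> X \<noteq> {} \<and> B - X \<noteq> {} \<longrightarrow>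
     (\<exists>v\<in>B \<inter> X. \<exists>w\<in>B - X. 0 < mult G v w))"

lemma component_subset:
  assumes "C \<in> components H"
  shows "C \<subseteq> verts H"
proof -
  obtain a where a: "a \<in> verts H" "C = {w. (a, w) \<in> (adjacent H)\<^sup>*}"
    using assms by (auto simp: components_def)
  have "w \<in> verts H" if "(a, w) \<in> (adjacent H)\<^sup>*" for w
    using that a(1) by (induction rule: rtrancl_induct) (auto simp: adjacent_def)
  then show ?thesis using a(2) by blast
qed

lemma connected_set_component:
  assumes "C \<in> components H"
  shows "connected_set H C"
  unfolding connected_set_def
proof (intro allI impI)
  fix X assume X: "C \<inter> X \<noteq> {} \<and> C - X \<noteq> {}"
  obtain a where a: "a \<in> verts H" "C = {w. (a, w) \<in> (adjacent H)\<^sup>*}"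
    using assms by (auto simp: components_def)
  show "\<exists>v\<in>C \<inter> X. \<exists>w\<in>C - X. 0 < mult H v w"
  proof (rule ccontr)
    assume no: "\<not> ?thesis"
    have "w \<in> X \<longleftrightarrow> a \<in> X" if "(a, w) \<in> (adjacent H)\<^sup>*" for w
      using that
    proof (induction rule: rtrancl_induct)
      case (step v w)
      have "v \<in> C" "w \<in> C" "0 < mult H v w" "0 < mult H w v"
        using step.hyps a(2) mult_commute[of H v w]
        by (auto simp: adjacent_def intro: rtrancl_into_rtrancl)
      then show ?case using no step.IH by blast
    qed simp
    then show False using X a(2) by blast
  qed
qed

lemma mult_induced_le:
  assumes "finite (edges G)"
  shows "mult (induced G W) v w \<le> mult G v w"
  using assms unfolding mult_def induced_def by (auto intro!: card_mono)

lemma connected_set_induced: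
  assumes "finite (edges G)" "connected_set (induced G W) C"
  shows "connected_set G C"
  unfolding connected_set_def
proof (intro allI impI)
  fix X assume "C \<inter> X \<noteq> {} \<and> C - X \<noteq> {}"
  then obtain v w where "v \<in> C \<inter> X" "w \<in> C - X" "0 < mult (induced G W) v w"
    using assms(2) unfolding connected_set_def by blast
  then show "\<exists>v\<in>C \<inter> X. \<exists>w\<in>C - X. 0 < mult G v w"
    using mult_induced_le[OF assms(1), of W v w] by (meson less_le_trans)
qed

text \<open>A chip crosses every edge that leaves the fired set: its inner end had a chip before the
  step, its outer end has one after it. A connected set that straddles the fired set is therefore
  hit both before and after.\<close>

lemma straddling_set_hit:
  fixes G :: "('v, 'e) multigraph" and D c :: "'v \<Rightarrow> int" and t :: int
  defines "before \<equiv> fire G D (\<lambda>v. max (c v) t)"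
    and "after \<equiv> fire G D (\<lambda>v. max (c v) (t - 1))"
  assumes fin: "finite (verts G)" and eff: "effective G before" "effective G after"
    and B: "B \<subseteq> verts G" "connected_set G B"
    and straddle: "B \<inter> {v. t \<le> c v} \<noteq> {}" "B - {v. t \<le> c v} \<noteq> {}"
  shows "B \<inter> supp G before \<noteq> {}" "B \<inter> supp G after \<noteq> {}"
proof -
  obtain v w where "v \<in> B \<inter> {v. t \<le> c v}" "w \<in> B - {v. t \<le> c v}" and m: "0 < mult G v w"
    using B(2)[unfolded connected_set_def, rule_format, OF conjI[OF straddle]] by (elim bexE)
  then have v: "v \<in> B" "t \<le> c v" and w: "w \<in> B" "c w < t" by auto
  have V: "v \<in> verts G" "w \<in> verts G" using v w B(1) by auto
  have "int (mult G v w) \<le> (\<Sum>x\<in>{x\<in>verts G. c x < t}. int (mult G v x))"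
    using V w fin by (intro member_le_sum) auto
  moreover have "0 \<le> after v" using eff(2) V by (simp add: effective_def)
  ultimately have "0 < before v"
    using fire_truncated_inside[where G = G and D = D and c = c and t = t, OF fin V(1) v(2)] m
    unfolding before_def after_def by linarith
  then show "B \<inter> supp G before \<noteq> {}" using v V by (auto simp: supp_def)
  have "int (mult G w v) \<le> (\<Sum>x\<in>{x\<in>verts G. t \<le> c x}. int (mult G w x))"
    using V v fin by (intro member_le_sum) auto
  moreover have "0 \<le> before w" using eff(1) V by (simp add: effective_def)
  ultimately have "0 < after w"
    using fire_truncated_outside[where G = G and D = D and c = c and t = t, OF fin V(2) w(2)] m
      mult_commute[of G v w]
    unfolding before_def after_def by linarith
  then show "B \<inter> supp G after \<noteq> {}" using w V by (auto simp: supp_def)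
qed

text \<open>Inside the fired set chips only decrease and outside it they only increase. A set whose
  status changes does not straddle the fired set, by the previous lemma, so the direction of the
  change tells on which side it lies.\<close>

lemma newly_hit_outside:
  fixes G :: "('v, 'e) multigraph" and D c :: "'v \<Rightarrow> int" and t :: int
  defines "before \<equiv> fire G D (\<lambda>v. max (c v) t)"
    and "after \<equiv> fire G D (\<lambda>v. max (c v) (t - 1))"
  assumes fin: "finite (verts G)" and eff: "effective G before" "effective G after"
    and B: "B \<subseteq> verts G" "connected_set G B"
    and hit: "B \<inter> supp G before = {}" "B \<inter> supp G after \<noteq> {}"
  shows "B \<inter> {v. t \<le> c v} = {}"
proof (rule ccontr)
  assume "B \<inter> {v. t \<le> c v} \<noteq> {}"
  then have sub: "B \<subseteq> {v. t \<le> c v}"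
    using straddling_set_hit(1)[OF fin eff[unfolded before_def after_def] B] hit(1)
    unfolding before_def by blast
  obtain w where w: "w \<in> B" "w \<in> verts G" "0 < after w"
    using hit(2) by (auto simp: supp_def)
  have "after w \<le> before w"
    using fire_truncated_inside[where G = G and D = D and c = c and t = t, OF fin w(2)] sub w(1)
    unfolding before_def after_def by (auto simp: subset_iff sum_nonneg)
  then show False using w hit(1) by (auto simp: supp_def)
qed

lemma newly_missed_inside:
  fixes G :: "('v, 'e) multigraph" and D c :: "'v \<Rightarrow> int" and t :: int
  defines "before \<equiv> fire G D (\<lambda>v. max (c v) t)"
    and "after \<equiv> fire G D (\<lambda>v. max (c v) (t - 1))"
  assumes fin: "finite (verts G)" and eff: "effective G before" "effective G after"
    and B: "B \<subseteq> verts G" "connected_set G B"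
    and hit: "B \<inter> supp G before \<noteq> {}" "B \<inter> supp G after = {}"
  shows "B \<subseteq> {v. t \<le> c v}"
proof (rule ccontr)
  assume "\<not> B \<subseteq> {v. t \<le> c v}"
  then have dis: "B \<inter> {v. t \<le> c v} = {}"
    using straddling_set_hit(2)[OF fin eff[unfolded before_def after_def] B] hit(2)
    unfolding after_def by blast
  obtain w where w: "w \<in> B" "w \<in> verts G" "0 < before w"
    using hit(1) by (auto simp: supp_def)
  have "c w < t" using dis w(1) by auto
  then have "before w \<le> after w"
    using fire_truncated_outside[where G = G and D = D and c = c and t = t, OF fin w(2)]
    unfolding before_def after_def by (auto intro: sum_nonneg)
  then show False using w hit(2) by (auto simp: supp_def)
qed

section \<open>Edge boundaries\<close>

lemma card_edge_boundary_le:
  assumes G: "finite_multigraph G" and U: "U \<subseteq> verts G"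
  shows "card (edge_boundary G U) \<le> (\<Sum>v\<in>U. \<Sum>w\<in>verts G - U. mult G v w)"
proof -
  have fin: "finite (verts G)" "finite (edges G)" and
    ends: "\<And>e. e \<in> edges G \<Longrightarrow> ends G e \<subseteq> verts G \<and> card (ends G e) \<in> {1, 2}"
    using G by (auto simp: finite_multigraph_def)
  have finU: "finite U" using U fin(1) by (rule finite_subset)
  let ?F = "\<lambda>v w. {e \<in> edges G. ends G e = {v, w}}"
  have "edge_boundary G U \<subseteq> (\<Union>v\<in>U. \<Union>w\<in>verts G - U. ?F v w)"
  proof
    fix e assume "e \<in> edge_boundary G U"
    then obtain v w where e: "e \<in> edges G" and vw: "v \<in> ends G e" "w \<in> ends G e" "v \<in> U" "w \<notin> U"
      unfolding edge_boundary_def by blast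
    have sub: "ends G e \<subseteq> verts G" and c: "card (ends G e) \<le> 2" using ends[OF e] by auto
    have "v \<noteq> w" using vw by blast
    then have "card {v, w} = 2" by simp
    then have "{v, w} = ends G e"
      using vw c finite_subset[OF sub fin(1)] by (intro card_seteq) auto
    then show "e \<in> (\<Union>v\<in>U. \<Union>w\<in>verts G - U. ?F v w)" using e vw sub by blast
  qed
  then have "card (edge_boundary G U) \<le> card (\<Union>v\<in>U. \<Union>w\<in>verts G - U. ?F v w)"
    using fin finU by (intro card_mono) auto
  also have "\<dots> \<le> (\<Sum>v\<in>U. card (\<Union>w\<in>verts G - U. ?F v w))"
    using finU by (rule card_UN_le)
  also have "\<dots> \<le> (\<Sum>v\<in>U. \<Sum>w\<in>verts G - U. mult G v w)"
    unfolding mult_def using fin by (intro sum_mono card_UN_le) auto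
  finally show ?thesis .
qed

text \<open>The vertices of the fired set must be able to pay for all edges that leave it.\<close>

lemma card_edge_boundary_level_set_le_deg:
  assumes G: "finite_multigraph G"
    and eff: "effective G (fire G D (\<lambda>v. max (c v) t))"
      "effective G (fire G D (\<lambda>v. max (c v) (t - 1)))"
  shows "int (card (edge_boundary G {v\<in>verts G. t \<le> c v})) \<le> deg G (fire G D (\<lambda>v. max (c v) t))"
proof -
  let ?U = "{v\<in>verts G. t \<le> c v}"
  have fin: "finite (verts G)" using G by (simp add: finite_multigraph_def)
  have diff: "verts G - ?U = {v\<in>verts G. c v < t}" by auto
  have "int (card (edge_boundary G ?U)) \<le> (\<Sum>v\<in>?U. \<Sum>w\<in>verts G - ?U. int (mult G v w))"
    using card_edge_boundary_le[OF G, of ?U] by (simp flip: of_nat_sum)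
  also have "\<dots> \<le> (\<Sum>v\<in>?U. fire G D (\<lambda>v. max (c v) t) v)"
    unfolding diff
  proof (rule sum_mono)
    fix v assume v: "v \<in> ?U"
    then have "0 \<le> fire G D (\<lambda>v. max (c v) (t - 1)) v" using eff(2) by (simp add: effective_def)
    then show "(\<Sum>w\<in>{v\<in>verts G. c v < t}. int (mult G v w)) \<le> fire G D (\<lambda>v. max (c v) t) v"
      using fire_truncated_inside[of G v t c D] fin v by simp
  qed
  also have "\<dots> \<le> deg G (fire G D (\<lambda>v. max (c v) t))"
    unfolding deg_def using fin eff(1) by (intro sum_mono2) (auto simp: effective_def)
  finally show ?thesis .
qed

lemma edge_boundary_complement:
  assumes "finite_multigraph G"
  shows "edge_boundary G (verts G - U) = edge_boundary G U"
  using assms unfolding edge_boundary_def finite_multigraph_def by blast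

lemma cheeger_mult_card_le:
  assumes fin: "finite (verts G)" and U: "U \<subseteq> verts G" "0 < card U"
    "2 * card U \<le> card (verts G)"
  shows "cheeger G * real (card U) \<le> real (card (edge_boundary G U))"
proof -
  have "cheeger G \<le> real (card (edge_boundary G U)) / real (card U)"
    unfolding cheeger_def using fin U by (intro Min_le) auto
  then show ?thesis using U(2) by (simp add: pos_le_divide_eq)
qed

lemma cheeger_mult_less_boundary:
  assumes G: "finite_multigraph G" and h: "0 < cheeger G" and U: "U \<subseteq> verts G" and x: "0 \<le> x"
    and big: "x < real (card U)" "x < real (card (verts G - U))"
  shows "cheeger G * x < real (card (edge_boundary G U))"
proof -
  have fin: "finite (verts G)" using G by (simp add: finite_multigraph_def)
  have sum: "card U + card (verts G - U) = card (verts G)"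
    using U fin by (metis card_Diff_subset card_mono finite_subset le_add_diff_inverse)
  \<comment> \<open>The Cheeger inequality applies to the smaller of the two sides.\<close>
  obtain W where W: "W \<subseteq> verts G" "x < real (card W)" "2 * card W \<le> card (verts G)"
    "edge_boundary G W = edge_boundary G U"
  proof (cases "2 * card U \<le> card (verts G)")
    case True
    then show ?thesis using that[of U] U big(1) by blast
  next
    case False
    then show ?thesis
      using that[of "verts G - U"] sum big(2) edge_boundary_complement[OF G] by auto
  qed
  have "cheeger G * x < cheeger G * real (card W)" using h W(2) by simp
  also have "\<dots> \<le> real (card (edge_boundary G W))"
    using W x by (intro cheeger_mult_card_le[OF fin]) auto
  finally show ?thesis using W(4) by simp
qed

section \<open>The lower bound on gonality\<close>

lemma int_switch:
  fixes a b :: int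
  assumes "a \<le> b" "P a" "\<not> P b"
  shows "\<exists>s. a < s \<and> s \<le> b \<and> P (s - 1) \<and> \<not> P s"
  using assms
proof (induction b rule: int_ge_induct)
  case (step i)
  show ?case
  proof (cases "P i")
    case True
    then show ?thesis using step by (intro exI[of _ "i + 1"]) auto
  next
    case False
    then obtain s where "a < s \<and> s \<le> i \<and> P (s - 1) \<and> \<not> P s" using step by blast
    then show ?thesis by (intro exI[of _ s]) auto
  qed
qed simp

text \<open>The exchange step of the argument: on the way from \<open>E\<close> to a divisor that hits \<open>B\<close>, some set of
  the family \<open>\<B>\<close> is given up, and the two sets are separated by a fired set whose
  boundary is bounded by the degree.\<close>

lemma exchange_separates:
  assumes G: "finite_multigraph G" and ne: "verts G \<noteq> {}"
    and family: "\<And>X. X \<in> \<B> \<Longrightarrow> X \<subseteq> verts G \<and> connected_set G X"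
    and E: "effective G E" and E': "effective G E'" "equivalent G E E'"
    and B: "B \<in> \<B>" "B \<inter> supp G E = {}" "B \<inter> supp G E' \<noteq> {}"
    and maximal: "\<And>F. effective G F \<Longrightarrow> equivalent G E F \<Longrightarrow>
      {X\<in>\<B>. X \<inter> supp G E \<noteq> {}} \<subseteq> {X\<in>\<B>. X \<inter> supp G F \<noteq> {}} \<Longrightarrow>
      {X\<in>\<B>. X \<inter> supp G E \<noteq> {}} = {X\<in>\<B>. X \<inter> supp G F \<noteq> {}}"
  shows "\<exists>U B'. U \<subseteq> verts G \<and> B' \<in> \<B> \<and> B' \<subseteq> U \<and> B \<subseteq> verts G - U \<and>
    int (card (edge_boundary G U)) \<le> deg G E"
proof -
  have fin: "finite (verts G)" using G by (simp add: finite_multigraph_def)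
  obtain c where c: "\<forall>w\<in>verts G. E' w = fire G E c w"
    using E'(2) equivalent_iff_fire[OF fin] by blast
  have "E' = fire G E c"
  proof
    fix w show "E' w = fire G E c w"
      using c E'(1) by (cases "w \<in> verts G") (auto simp: effective_def divisors_def fire_def)
  qed
  then have effc: "effective G (fire G E c)" using E'(1) by simp
  define F where "F t = fire G E (\<lambda>v. max (c v) t)" for t
  define U where "U t = {v\<in>verts G. t \<le> c v}" for t
  have effF: "effective G (F t)" for t
    unfolding F_def using E effc by (rule effective_fire_truncated)
  have eqF: "equivalent G E (F t)" for t
    unfolding equivalent_iff_fire[OF fin] F_def by blast
  define l where "l = Min (c ` verts G)"
  define m where "m = Max (c ` verts G)"
  have lm: "l \<le> c v" "c v \<le> m" if "v \<in> verts G" for v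
    using that fin by (auto simp: l_def m_def)
  then have "l \<le> m" using ne by force
  have supp_m: "supp G (F m) = supp G E"
    using lm(2) by (auto simp: F_def fire_def supp_def max_absorb2)
  have supp_l: "supp G (F l) = supp G E'"
    using lm(1) c by (auto simp: F_def fire_def supp_def max_absorb1)
  have Bc: "B \<subseteq> verts G" "connected_set G B" using family[OF B(1)] by auto
  obtain s where s: "s \<le> m" "B \<inter> supp G (F (s - 1)) \<noteq> {}" "B \<inter> supp G (F s) = {}"
    using int_switch[of l m "\<lambda>t. B \<inter> supp G (F t) \<noteq> {}"] \<open>l \<le> m\<close> B(2,3) supp_m supp_l by auto
  have out: "B \<inter> {v. s \<le> c v} = {}"
    using newly_hit_outside[of G E c s B] fin effF Bc s unfolding F_def by blast
  \<comment> \<open>The gain of \<open>B\<close> must be offset by a loss, since \<open>E\<close> is maximal.\<close>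
  have "\<not> {X\<in>\<B>. X \<inter> supp G E \<noteq> {}} \<subseteq> {X\<in>\<B>. X \<inter> supp G (F (s - 1)) \<noteq> {}}"
    using maximal[OF effF eqF, of "s - 1"] B(1,2) s(2) by blast
  then obtain B' where B': "B' \<in> \<B>" "B' \<inter> supp G E \<noteq> {}" "B' \<inter> supp G (F (s - 1)) = {}"
    by blast
  obtain t where t: "s - 1 < t" "B' \<inter> supp G (F (t - 1)) = {}" "B' \<inter> supp G (F t) \<noteq> {}"
    using int_switch[of "s - 1" m "\<lambda>t. B' \<inter> supp G (F t) = {}"] s(1) B' supp_m by auto
  have B'c: "B' \<subseteq> verts G" "connected_set G B'" using family[OF B'(1)] by auto
  have "B' \<subseteq> {v. t \<le> c v}"
    using newly_missed_inside[of G E c t B'] fin effF B'c t(2,3) unfolding F_def by blast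
  then have "B' \<subseteq> U s" using t(1) B'c(1) by (force simp: U_def)
  moreover have "B \<subseteq> verts G - U s" using out Bc(1) by (auto simp: U_def)
  moreover have "int (card (edge_boundary G (U s))) \<le> deg G E"
    using card_edge_boundary_level_set_le_deg[OF G, of E c s] effF deg_equivalent[OF G eqF, of s]
    unfolding F_def U_def by simp
  ultimately show ?thesis using B'(1) by (intro exI[of _ "U s"] exI[of _ B']) (auto simp: U_def)
qed

theorem theorem1p1:
  fixes G :: "('v, 'e) multigraph" and u :: real
  assumes "finite_multigraph G"
    and "card (verts G) \<ge> 2"
    and "0 < u" and "u \<le> 1/2"
  shows "real_of_int (gonality G) \<ge>
    min (real_of_int (separating_degree G u)) (cheeger G * u * real (card (verts G)))"
proof (rule ccontr)
  let ?x = "u * real (card (verts G))"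
  assume "\<not> ?thesis"
  then have sep: "gonality G < separating_degree G u"
    and chee: "real_of_int (gonality G) < cheeger G * ?x"
    by (auto simp: mult.assoc)
  have fin: "finite (verts G)" "finite (edges G)"
    using assms(1) by (auto simp: finite_multigraph_def)
  have ne: "verts G \<noteq> {}" using assms(2) by auto
  then obtain v0 where v0: "v0 \<in> verts G" by blast
  obtain D where D: "positive_rank G D" "deg G D = gonality G"
    using gonality_attained[OF assms(1) ne] by blast
  have x: "0 < ?x" using assms(2,3) by simp
  \<comment> \<open>The Cheeger bound exceeds the gonality, which is positive; hence \<open>h(G) > 0\<close>.\<close>
  have "1 \<le> gonality G" using deg_positive_rank[OF assms(1) ne D(1)] D(2) by simp
  then have "0 < cheeger G * ?x" using chee by linarith
  then have h: "0 < cheeger G" using x by (simp only: zero_less_mult_pos2)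
  define \<B> where "\<B> = {X. X \<subseteq> verts G \<and> connected_set G X \<and> ?x < real (card X)}"
  define S where "S = {E. effective G E \<and> equivalent G D E}"
  define H where "H E = {X\<in>\<B>. X \<inter> supp G E \<noteq> {}}" for E
  have "S \<noteq> {}" using positive_rank_chip_at[OF fin(1) D(1) v0] by (auto simp: S_def)
  moreover have "finite (H ` S)"
    by (rule finite_subset[of _ "Pow (Pow (verts G))"]) (use fin(1) in \<open>auto simp: H_def \<B>_def\<close>)
  ultimately obtain E where ES: "E \<in> S" and max: "\<forall>F\<in>S. H E \<subseteq> H F \<longrightarrow> H E = H F"
    using finite_has_maximal[of "H ` S"] by auto
  have E: "effective G E" "equivalent G D E" using ES by (auto simp: S_def)
  have degE: "deg G E = gonality G" using deg_equivalent[OF assms(1) E(2)] D(2) by simp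
  have "\<not> separating_degree G u \<le> deg G E" using sep degE by simp
  then obtain B where C: "B \<in> components (induced G (verts G - supp G E))" and big: "?x < real (card B)"
    using separating_degree_attained[of u G] assms(3) E(1) by (meson less_imp_le not_le)
  have sub: "B \<subseteq> verts G - supp G E" using component_subset[OF C] by (simp add: induced_def)
  have B: "B \<in> \<B>"
    using sub big connected_set_induced[OF fin(2) connected_set_component[OF C]]
    by (auto simp: \<B>_def)
  have "B \<noteq> {}" using big x by auto
  then obtain v where v: "v \<in> B" by blast
  then obtain E' where E': "effective G E'" "equivalent G D E'" "v \<in> supp G E'"
    using positive_rank_chip_at[OF fin(1) D(1)] sub by blast
  have "\<exists>U B'. U \<subseteq> verts G \<and> B' \<in> \<B> \<and> B' \<subseteq> U \<and> B \<subseteq> verts G - U \<and>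
      int (card (edge_boundary G U)) \<le> deg G E"
  proof (rule exchange_separates[OF assms(1) ne _ E(1) E'(1) _ B])
    show "equivalent G E E'" using equivalent_trans[OF equivalent_sym[OF E(2)] E'(2)] .
    show "{X\<in>\<B>. X \<inter> supp G E \<noteq> {}} = {X\<in>\<B>. X \<inter> supp G F \<noteq> {}}"
      if "effective G F" "equivalent G E F"
        "{X\<in>\<B>. X \<inter> supp G E \<noteq> {}} \<subseteq> {X\<in>\<B>. X \<inter> supp G F \<noteq> {}}" for F
      using max that equivalent_trans[OF E(2) that(2)] unfolding H_def S_def by blast
  qed (use sub v E'(3) in \<open>auto simp: \<B>_def\<close>)
  then obtain U B' where U: "U \<subseteq> verts G" "B' \<in> \<B>" "B' \<subseteq> U" "B \<subseteq> verts G - U"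
    and bd: "int (card (edge_boundary G U)) \<le> deg G E"
    by blast
  have "card B' \<le> card U" "card B \<le> card (verts G - U)"
    using U fin(1) by (auto intro!: card_mono intro: finite_subset)
  then have "?x < real (card U)" "?x < real (card (verts G - U))"
    using U(2) big by (auto simp: \<B>_def)
  then have "cheeger G * ?x < real (card (edge_boundary G U))"
    using cheeger_mult_less_boundary[OF assms(1) h U(1)] x by simp
  moreover have "real (card (edge_boundary G U)) \<le> real_of_int (gonality G)"
    using bd degE by linarith
  ultimately show False using chee by simp
qed

end
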